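(* Let $\{u_n\}_{n\ge0}$ be an orthonormal system in $L^2$ (with $u_n:(\Omega,\mathcal F,\mu)\to\mathcal V$, $\mathcal V$ a Hilbert space) having the Hardy property with constant $C$. Let $\{c_n\}_{n\ge0}$ be a sequence of numbers with $\sum_{n=0}^\infty\log_2(n+1)|c_n|^2<\infty$, and let $X$ be the partial sum process $X_n(\omega)=\sum_{k=0}^nc_ku_k(\omega)$. Then $\mathbf X=(X,A(X))$, i.e. $X$ enhanced by its area process, is a geometric $2$-rough process, and $$\int_\Omega\|\mathbf X(\omega)\|_{G^{(2)}}^2\,\mu(d\omega)\le(604+26C)\sum_{n=0}^\infty\log_2(n+1)|c_n|^2 .$$
   Context: $\mathbb N=\{0,1,2,\dots\}$, $\bigtriangleup_{\mathbb N}=\{(i,j)\in\mathbb N^2: i\le j\}$. Orthonormal system in $L^2$: measurable maps $u_n:(\Omega,\mathcal F,\mu)\to\mathcal V$, $n\in\mathbb N$, from a measure space to a Hilbert space with $\int_\Omega\langle u_n(\omega),u_m(\omega)\rangle\,\mu(d\omega)=\delta_{mn}$ for all $n,m$. Hardy property with constant $C$: for every sequence of numbers $\{a_n\}_{n\ge0}$ with $\sum_n|a_n|^2<\infty$, $\int_\Omega\sup_{0\le i\le j<\infty}\big\|\sum_{k=i}^ja_ku_k(\omega)\big\|^2\mu(d\omega)\le C\sum_{n=0}^\infty|a_n|^2$. $\mathcal V\otimes\mathcal V$ carries a norm with $\|u\otimes v\|\le\|u\|\|v\|$ for all $u,v\in\mathcal V$; $\mathcal V^{\otimes2}$ is its completion;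 $[u,v]:=u\otimes v-v\otimes u$. $p$-variation: for $\alpha:\bigtriangleup_{\mathbb N}\to E$ ($E$ a Banach space) with $\alpha(k,k)=0$ and $p\in[1,\infty)$, $\|\alpha\|_{p\text{-}var}:=\sup_{N\ge1}\big(\sup_{0\le k_0<\cdots<k_n\le N}\sum_{j=0}^{n-1}\|\alpha(k_j,k_{j+1})\|^p\big)^{1/p}$. A function $\gamma:\mathbb N\to E$ is regarded as a function on $\bigtriangleup_{\mathbb N}$ via $(k_1,k_2)\mapsto\gamma(k_1)-\gamma(k_2)$. Area: for $\gamma:\mathbb N\to\mathcal V$, $A(\gamma):\bigtriangleup_{\mathbb N}\to\mathcal V^{\otimes2}$ is $A(\gamma)(k_1,k_2)=0$ if $k_2\in\{k_1,k_1+1\}$, and for $k_2\ge k_1+2$, $A(\gamma)(k_1,k_2)=\frac12\sum_{k_1\le j_1<j_2\le k_2-1}[\gamma(j_1+1)-\gamma(j_1),\gamma(j_2+1)-\gamma(j_2)]$. The area process of a process $X$ indexed by $\mathbb N$ is $(A(X))(\omega):=A(X(\omega))$. $2$-rough norm: $\|(\gamma,\alpha)\|_{G^{(2)}}:=(\|\gamma\|_{2\text{-}var}^2+\|\alpha\|_{1\text{-}var})^{1/2}$. The pair $(\gamma,A(\gamma))$ is a geometric $2$-rough path if $\|(\gamma,A(\gamma))\|_{G^{(2)}}<\infty$. $(X,A(X))$ is a geometric $2$-rough process if $(X(\omega),A(X(\omega)))$ is a geometric $2$-rough path for $\mu$-almost every $\omega$. *)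

theory Defs
  imports "HOL-Analysis.Analysis"
begin

text \<open>
  Scalars are taken from an arbitrary finite-dimensional \<^class>\<open>real_normed_field\<close>. Up to isometric
  isomorphism there are exactly two of them, \<^typ>\<open>real\<close> and \<^typ>\<open>complex\<close>, so real and complex Hilbert
  spaces are treated simultaneously. On these fields the conjugate of z is $|z|^2 / z$ (for z = 0
  this is 0 by the convention for division by zero).
\<close>

definition scalar_conj :: "'k::real_normed_field \<Rightarrow> 'k"
  where "scalar_conj z = of_real ((norm z)\<^sup>2) / z"

lemma scalar_conj_real [simp]: "scalar_conj (x :: real) = x"
  by (simp add: scalar_conj_def power2_eq_square)

lemma scalar_conj_complex [simp]: "scalar_conj (z :: complex) = cnj z"
proof (cases "z = 0")
  case False
  then show ?thesis
    using complex_norm_square[of z] by (simp add: scalar_conj_def)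
qed (simp add: scalar_conj_def)

locale normed_space_over = vector_space scale
  for scale :: "'k::{real_normed_field, euclidean_space} \<Rightarrow> 'v::real_normed_vector \<Rightarrow> 'v" +
  assumes scale_of_real: "scale (of_real r) x = r *\<^sub>R x"
    and norm_scale: "norm (scale a x) = norm a * norm x"

locale hilbert_space = normed_space_over scale
  for scale :: "'k::{real_normed_field, euclidean_space} \<Rightarrow> 'v::banach \<Rightarrow> 'v" +
  fixes ip :: "'v \<Rightarrow> 'v \<Rightarrow> 'k"
  assumes ip_add_left: "ip (x + y) z = ip x z + ip y z"
    and ip_scale_left: "ip (scale a x) y = a * ip x y"
    and ip_commute: "ip y x = scalar_conj (ip x y)"
    and ip_norm: "ip x x = of_real ((norm x)\<^sup>2)"

lemma hilbert_space_real:
  "hilbert_space scaleR (inner :: 'v::{real_inner, banach} \<Rightarrow> 'v \<Rightarrow> real)"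
  by unfold_locales
    (auto simp: algebra_simps inner_add_left inner_commute power2_norm_eq_inner)

lemma hilbert_space_complex: "hilbert_space (*) (\<lambda>z w. z * cnj w)"
  by unfold_locales
    (auto simp: algebra_simps norm_mult scaleR_conv_of_real complex_norm_square[symmetric] of_real_power[symmetric] simp del: of_real_power)

text \<open>
  The completion of the algebraic tensor product of V with itself, for a norm with
  \<open>norm (u \<otimes> v) \<le> norm u * norm v\<close>: up to isometry it is a Banach space W with a bilinear map
  V x V \<rightarrow> W for which the span of the elementary tensors is dense and is a copy of the algebraic
  tensor product. The latter means that the tensors of the elements of a basis of V (equivalently,
  of any linearly independent set) are distinct and linearly independent.
\<close>

locale completed_tensor_square =
  V: normed_space_over scaleV + W: normed_space_over scaleW
  for scaleV :: "'k::{real_normed_field, euclidean_space} \<Rightarrow> 'v::real_normed_vector \<Rightarrow> 'v"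
    and scaleW :: "'k \<Rightarrow> 'w::banach \<Rightarrow> 'w" +
  fixes tensor :: "'v \<Rightarrow> 'v \<Rightarrow> 'w"
  assumes linear_left: "Vector_Spaces.linear scaleV scaleW (\<lambda>x. tensor x y)"
    and linear_right: "Vector_Spaces.linear scaleV scaleW (\<lambda>y. tensor x y)"
    and inj_on_basis: "V.independent B \<Longrightarrow> inj_on (\<lambda>(x, y). tensor x y) (B \<times> B)"
    and independent_basis: "V.independent B \<Longrightarrow> W.independent ((\<lambda>(x, y). tensor x y) ` (B \<times> B))"
    and dense: "closure (W.span (range (\<lambda>(x, y). tensor x y))) = UNIV"
    and norm_tensor_le: "norm (tensor x y) \<le> norm x * norm y"

definition orthonormal_system ::
    "'o measure \<Rightarrow> ('v::banach \<Rightarrow> 'v \<Rightarrow> 'k::{real_normed_field, euclidean_space})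
      \<Rightarrow> (nat \<Rightarrow> 'o \<Rightarrow> 'v) \<Rightarrow> bool"
  where "orthonormal_system M ip u \<longleftrightarrow>
    (\<forall>n. u n \<in> borel_measurable M) \<and>
    (\<forall>n m. has_bochner_integral M (\<lambda>\<omega>. ip (u n \<omega>) (u m \<omega>)) (if n = m then 1 else 0))"

definition hardy_property ::
    "'o measure \<Rightarrow> ('k::{real_normed_field, euclidean_space} \<Rightarrow> 'v::banach \<Rightarrow> 'v)
      \<Rightarrow> (nat \<Rightarrow> 'o \<Rightarrow> 'v) \<Rightarrow> real \<Rightarrow> bool"
  where "hardy_property M scaleV u C \<longleftrightarrow>
    (\<forall>a :: nat \<Rightarrow> 'k. summable (\<lambda>n. (norm (a n))\<^sup>2) \<longrightarrow>
      (\<integral>\<^sup>+\<omega>. (SUP (i, j)\<in>{(i, j). i \<le> j}. ennreal ((norm (\<Sum>k=i..j. scaleV (a k) (u k \<omega>)))\<^sup>2)) \<partial>M)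
        \<le> ennreal (C * (\<Sum>n. (norm (a n))\<^sup>2)))"

text \<open>Real powers of extended nonnegative reals, for positive exponents only.\<close>

definition ennreal_powr :: "ennreal \<Rightarrow> real \<Rightarrow> ennreal"
  where "ennreal_powr x a = (if x = top then top else ennreal (enn2real x powr a))"

text \<open>
  Functions on pairs \<open>i \<le> j\<close> are represented as curried functions on all pairs; only the values at
  pairs \<open>i \<le> j\<close> matter below. A list \<open>[k\<^sub>0, \<dots>, k\<^sub>n]\<close> represents \<open>k\<^sub>0 < \<dots> < k\<^sub>n\<close>.
\<close>

definition partitions_upto :: "nat \<Rightarrow> nat list set"
  where "partitions_upto N = {ks. ks \<noteq> [] \<and> sorted_wrt (<) ks \<and> set ks \<subseteq> {0..N}}"

definition p_variation :: "real \<Rightarrow> (nat \<Rightarrow> nat \<Rightarrow> 'e::banach) \<Rightarrow> ennreal"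
  where "p_variation p \<alpha> =
    (SUP N\<in>{1..}. ennreal_powr
      (SUP ks\<in>partitions_upto N.
        ennreal (\<Sum>j<length ks - 1. norm (\<alpha> (ks ! j) (ks ! (j + 1))) powr p))
      (1 / p))"

definition increments :: "(nat \<Rightarrow> 'e::banach) \<Rightarrow> nat \<Rightarrow> nat \<Rightarrow> 'e"
  where "increments \<gamma> k\<^sub>1 k\<^sub>2 = \<gamma> k\<^sub>1 - \<gamma> k\<^sub>2"

definition bracket :: "('v \<Rightarrow> 'v \<Rightarrow> 'w::banach) \<Rightarrow> 'v \<Rightarrow> 'v \<Rightarrow> 'w"
  where "bracket tensor x y = tensor x y - tensor y x"

definition area :: "('v::banach \<Rightarrow> 'v \<Rightarrow> 'w::banach) \<Rightarrow> (nat \<Rightarrow> 'v) \<Rightarrow> nat \<Rightarrow> nat \<Rightarrow> 'w"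
  where "area tensor \<gamma> k\<^sub>1 k\<^sub>2 =
    (if k\<^sub>2 \<ge> k\<^sub>1 + 2 then
       (1 / 2) *\<^sub>R (\<Sum>(j\<^sub>1, j\<^sub>2)\<in>{(j\<^sub>1, j\<^sub>2). k\<^sub>1 \<le> j\<^sub>1 \<and> j\<^sub>1 < j\<^sub>2 \<and> j\<^sub>2 \<le> k\<^sub>2 - 1}.
         bracket tensor (\<gamma> (j\<^sub>1 + 1) - \<gamma> j\<^sub>1) (\<gamma> (j\<^sub>2 + 1) - \<gamma> j\<^sub>2))
     else 0)"

definition rough_norm :: "(nat \<Rightarrow> 'v::banach) \<Rightarrow> (nat \<Rightarrow> nat \<Rightarrow> 'w::banach) \<Rightarrow> ennreal"
  where "rough_norm \<gamma> \<alpha> =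
    ennreal_powr ((p_variation 2 (increments \<gamma>))\<^sup>2 + p_variation 1 \<alpha>) (1 / 2)"

definition geometric_2_rough_path :: "('v::banach \<Rightarrow> 'v \<Rightarrow> 'w::banach) \<Rightarrow> (nat \<Rightarrow> 'v) \<Rightarrow> bool"
  where "geometric_2_rough_path tensor \<gamma> \<longleftrightarrow> rough_norm \<gamma> (area tensor \<gamma>) < top"

definition geometric_2_rough_process ::
    "'o measure \<Rightarrow> ('v::banach \<Rightarrow> 'v \<Rightarrow> 'w::banach) \<Rightarrow> (nat \<Rightarrow> 'o \<Rightarrow> 'v) \<Rightarrow> bool"
  where "geometric_2_rough_process M tensor X \<longleftrightarrow>
    (AE \<omega> in M. geometric_2_rough_path tensor (\<lambda>n. X n \<omega>))"

definition partial_sum_process ::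
    "('k \<Rightarrow> 'v::banach \<Rightarrow> 'v) \<Rightarrow> (nat \<Rightarrow> 'k) \<Rightarrow> (nat \<Rightarrow> 'o \<Rightarrow> 'v) \<Rightarrow> nat \<Rightarrow> 'o \<Rightarrow> 'v"
  where "partial_sum_process scaleV c u n \<omega> = (\<Sum>k\<le>n. scaleV (c k) (u k \<omega>))"

end

theory Submission
  imports Defs
begin

text \<open>
  Let $H(P)$ be the Hardy maximal function of the terms $c_k u_k$ with $k \in P$. For
  $k \le q \le l$ and $\{k+1, \dots, l\} \subseteq P$ the squared increment $|X_l - X_k|^2$ is at
  most $H(P)$. By Chen's identity the area satisfies
  $|A(k,l)| \le |A(k,q)| + |A(q,l)| + |X_q - X_k| |X_l - X_q|$, and the last product is at most
  $H(P)$ as well. So both functions are costs of steps $(k,l]$ for which cutting a step inside $P$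
  at $q$ is paid for by a single $H(P)$ (\<open>splittable_cost_square_increment\<close>,
  \<open>splittable_cost_area\<close>).

  Inserting one time $q$ into a partition cuts at most one of its steps
  (\<open>path_cost_insert\<close>). Insert the times $2^m - 1$ for all $m$, from left to right, and then the
  dyadic midpoints inside each block of indices $2^m \le k < 2^{m+1}$, until all steps have length
  at most one. At the cut at $2^{m+1} - 1$ all times left to treat lie in a tail, which is paid for
  with $P = \{2^m, 2^m + 1, \dots\}$; inside a block $P$ is a dyadic interval. Every
  partition therefore costs at most the sum $G$ of the numbers $H(P)$ over all these tails and
  dyadic intervals, uniformly in the partition (\<open>path_cost_le_total_weight\<close>). Pathwise this gives
  $\|X\|_{2-var}^2 \le G$ and $\|A(X)\|_{1-var} \le G$.

  The Hardy property gives $\int H(P) \le C \sum_{k \in P} |c_k|^2$. An index $k$ with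
  $2^a \le k < 2^{a+1}$ lies in $a + 1$ tails and in $a + 1$ dyadic intervals, and
  $2(a+1) \le 4 \log_2(k+1)$; the index $0$ lies in none. Hence
  $\int G \le 4 C \sum_k \log_2(k+1) |c_k|^2$ (\<open>integral_total_weight\<close>), and the squared rough norm,
  which is at most $2G$, has integral at most $8 C \sum_k \log_2(k+1) |c_k|^2$.
  For $C \ge 0$ the constant $8C$ is below $604 + 26C$.

  Measurability needs care because the Hilbert space may be nonseparable: sums of Borel
  functions into it can fail to be Borel. Norms of such sums are nevertheless measurable, being
  functions of the Gram matrix (\<open>measurable_norm_sum\<close>). The rough norm itself is only
  compared pointwise with the measurable function $2G$.
\<close>

section \<open>Costs of partitions and dyadic splitting\<close>

text \<open>
  Lists need only be weakly sorted below. Repeated times will cost nothing, and so a new time may be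
  inserted without asking whether it is already present.
\<close>

fun path_cost :: "(nat \<Rightarrow> nat \<Rightarrow> ennreal) \<Rightarrow> nat list \<Rightarrow> ennreal" where
  "path_cost \<kappa> (k # l # ks) = \<kappa> k l + path_cost \<kappa> (l # ks)"
| "path_cost \<kappa> _ = 0"

lemma path_cost_conv_sum:
  "path_cost \<kappa> ks = (\<Sum>j<length ks - 1. \<kappa> (ks ! j) (ks ! (j + 1)))"
proof (induction \<kappa> ks rule: path_cost.induct)
  case (1 \<kappa> k l ks)
  then show ?case
    by (simp add: sum.lessThan_Suc_shift del: sum.lessThan_Suc)
qed auto

lemma path_cost_append:
  assumes "xs \<noteq> []" "ys \<noteq> []"
  shows "path_cost \<kappa> (xs @ ys) = path_cost \<kappa> xs + \<kappa> (last xs) (hd ys) + path_cost \<kappa> ys"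
  using assms
proof (induction \<kappa> xs rule: path_cost.induct)
  case (1 \<kappa> k l ks)
  then show ?case by (simp add: add.assoc)
next
  case ("2_2" \<kappa> k)
  then show ?case by (cases ys) auto
qed auto

locale splittable_cost =
  fixes \<kappa> :: "nat \<Rightarrow> nat \<Rightarrow> ennreal"
    and h :: "nat set \<Rightarrow> ennreal"
  assumes cost_refl: "\<kappa> k k = 0"
    and cost_step: "\<kappa> k (Suc k) \<le> h {k<..Suc k}"
    and cost_split: "\<lbrakk>k \<le> q; q \<le> l; {k<..l} \<subseteq> P\<rbrakk> \<Longrightarrow> \<kappa> k l \<le> \<kappa> k q + \<kappa> q l + h P"
begin

lemma path_cost_constant:
  assumes "set ks \<subseteq> {k}"
  shows "path_cost \<kappa> ks = 0"
  using assms by (induction ks rule: induct_list012) (auto simp: cost_refl)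

text \<open>
  Only the step from the last time before \<open>q\<close> to the first time after it is cut, so the error term
  \<open>h P\<close> occurs once, however many steps the partition has.
\<close>

lemma path_cost_insert:
  assumes "sorted (xs @ ys)" "set (xs @ ys) \<subseteq> {p..r}" "\<forall>x\<in>set xs. x \<le> q" "\<forall>y\<in>set ys. q \<le> y"
    and P: "{p<..r} \<subseteq> P"
  shows "path_cost \<kappa> (xs @ ys) \<le> path_cost \<kappa> (xs @ [q]) + path_cost \<kappa> (q # ys) + h P"
proof (cases "xs = [] \<or> ys = []")
  case True
  then show ?thesis
  proof
    assume "xs = []"
    then show ?thesis by (cases ys) (auto simp: add.assoc intro: add_increasing add_increasing2)
  next
    assume "ys = []"
    then show ?thesis
      by (cases "xs = []") (auto simp: path_cost_append add.assoc intro: add_increasing2)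
  qed
next
  case False
  then have ne: "xs \<noteq> []" "ys \<noteq> []" by auto
  have "last xs \<in> set xs" "hd ys \<in> set ys" using ne by auto
  then have "last xs \<le> q" "q \<le> hd ys" "p \<le> last xs" "hd ys \<le> r" using assms by auto
  then have "\<kappa> (last xs) (hd ys) \<le> \<kappa> (last xs) q + \<kappa> q (hd ys) + h P"
    using P by (intro cost_split) auto
  moreover have "path_cost \<kappa> (q # ys) = \<kappa> q (hd ys) + path_cost \<kappa> ys"
    using ne by (cases ys) auto
  ultimately show ?thesis
    using ne by (simp add: path_cost_append) (metis (no_types, lifting) add.assoc add.commute add_left_mono add_right_mono)
qed

text \<open>
  Bounds on the two sides of \<open>q\<close> combine to a bound on the whole interval of times: this is the
  induction step for both the tails and the dyadic intervals.
\<close>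

lemma path_cost_split:
  assumes "sorted ks" "set ks \<subseteq> {p..r}" "p \<le> q" "q \<le> r"
    and P: "{p<..r} \<subseteq> P"
    and left: "\<And>xs. \<lbrakk>sorted xs; set xs \<subseteq> {p..q}\<rbrakk> \<Longrightarrow> path_cost \<kappa> xs \<le> a"
    and right: "\<And>ys. \<lbrakk>sorted ys; set ys \<subseteq> {q..r}\<rbrakk> \<Longrightarrow> path_cost \<kappa> ys \<le> b"
  shows "path_cost \<kappa> ks \<le> a + b + h P"
proof -
  define xs ys where "xs = filter (\<lambda>k. k < q) ks" and "ys = filter (\<lambda>k. q \<le> k) ks"
  have "sorted (xs @ ys)"
    using assms(1) by (auto simp: xs_def ys_def sorted_append sorted_wrt_filter)
  moreover have "mset (xs @ ys) = mset ks"
    unfolding xs_def ys_def using multiset_partition[of "mset ks" "\<lambda>k. k < q"]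
    by (simp add: not_less)
  ultimately have ks: "ks = xs @ ys"
    using assms(1) by (metis properties_for_sort sorted_sort_id)
  have "path_cost \<kappa> ks \<le> path_cost \<kappa> (xs @ [q]) + path_cost \<kappa> (q # ys) + h P"
    using assms unfolding ks by (intro path_cost_insert[where p=p and r=r]) (auto simp: xs_def ys_def)
  also have "\<dots> \<le> a + b + h P"
    using assms by (intro add_mono left right)
      (auto simp: xs_def ys_def sorted_append sorted_wrt_filter)
  finally show ?thesis .
qed

end

text \<open>
  The sum of \<open>h\<close> over all dyadic subintervals of \<open>{p<..p + 2 ^ s}\<close>, including the interval itself
  and the singletons.
\<close>

fun dyadic_weight :: "(nat set \<Rightarrow> ennreal) \<Rightarrow> nat \<Rightarrow> nat \<Rightarrow> ennreal" where
  "dyadic_weight h 0 p = h {p<..Suc p}"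
| "dyadic_weight h (Suc s) p =
     dyadic_weight h s p + dyadic_weight h s (p + 2 ^ s) + h {p<..p + 2 ^ Suc s}"

text \<open>
  Times \<open>k \<ge> 2 ^ m - 1\<close> correspond to indices \<open>n \<ge> 2 ^ m\<close> of terms, since the step from \<open>k\<close> to \<open>l\<close>
  contributes the terms with index in \<open>{k<..l}\<close>. So the first summand belongs to the block
  \<open>{2 ^ m..<2 ^ Suc m}\<close> of indices, and the second one to the tail beginning there.
\<close>

definition scale_weight :: "(nat set \<Rightarrow> ennreal) \<Rightarrow> nat \<Rightarrow> ennreal" where
  "scale_weight h m = dyadic_weight h m (2 ^ m - 1) + h {2 ^ m - 1<..}"

context splittable_cost
begin

lemma path_cost_le_dyadic_weight:
  assumes "sorted ks" "set ks \<subseteq> {p..p + 2 ^ s}"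
  shows "path_cost \<kappa> ks \<le> dyadic_weight h s p"
  using assms
proof (induction s arbitrary: p ks)
  case 0
  have "sorted ks \<Longrightarrow> set ks \<subseteq> {p, Suc p} \<Longrightarrow> path_cost \<kappa> ks \<le> \<kappa> p (Suc p)" for ks
  proof (induction ks rule: induct_list012)
    case (3 k l ks)
    from 3(3,4) consider "k = l" | "k = p" "l = Suc p" "set (l # ks) \<subseteq> {Suc p}"
      by fastforce
    then show ?case
    proof cases
      case 1
      then show ?thesis using "3.IH"(2) "3.prems" by (simp add: cost_refl)
    next
      case 2
      then show ?thesis using path_cost_constant[of "l # ks"] by simp
    qed
  qed auto
  moreover have "{p..p + 2 ^ 0} = {p, Suc p}" by auto
  ultimately show ?case
    using 0 cost_step[of p] by (metis dyadic_weight.simps(1) order_trans)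
next
  case (Suc s)
  show ?case
    unfolding dyadic_weight.simps
    by (rule path_cost_split[where p=p and q="p + 2 ^ s" and r="p + 2 ^ Suc s"])
      (use Suc in \<open>auto simp: mult_2 add.assoc\<close>)
qed

text \<open>
  Tails, and not the initial intervals \<open>{0<..2 ^ m - 1}\<close>, pay for the cuts between the blocks: an
  index \<open>k\<close> lies in only logarithmically many tails, but in infinitely many initial intervals.
\<close>

lemma path_cost_le_scale_weight:
  assumes "sorted ks" "set ks \<subseteq> {2 ^ m - 1..2 ^ (m + d) - 1}"
  shows "path_cost \<kappa> ks \<le> (\<Sum>i=m..<m + d. scale_weight h i)"
  using assms
proof (induction d arbitrary: m ks)
  case 0
  then have "set ks \<subseteq> {2 ^ m - 1}" by auto
  then show ?case by (simp add: path_cost_constant)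
next
  case (Suc d)
  have pow: "2 ^ Suc m - 1 = (2 ^ m - 1) + (2::nat) ^ m"
    by (simp add: mult_2)
  have mono: "(2::nat) ^ Suc m \<le> 2 ^ (m + Suc d)"
    by (intro power_increasing) auto
  have "path_cost \<kappa> ks \<le> dyadic_weight h m (2 ^ m - 1) + (\<Sum>i=Suc m..<Suc m + d. scale_weight h i) + h {2 ^ m - 1<..}"
  proof (rule path_cost_split[where p="2 ^ m - 1" and q="2 ^ Suc m - 1" and r="2 ^ (m + Suc d) - 1"])
    show "path_cost \<kappa> ys \<le> (\<Sum>i=Suc m..<Suc m + d. scale_weight h i)"
      if "sorted ys" "set ys \<subseteq> {2 ^ Suc m - 1..2 ^ (m + Suc d) - 1}" for ys
      using that by (intro Suc.IH) simp_all
    show "path_cost \<kappa> xs \<le> dyadic_weight h m (2 ^ m - 1)"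
      if "sorted xs" "set xs \<subseteq> {2 ^ m - 1..2 ^ Suc m - 1}" for xs
      using that unfolding pow by (rule path_cost_le_dyadic_weight)
    show "(2::nat) ^ Suc m - 1 \<le> 2 ^ (m + Suc d) - 1"
      using mono by (rule diff_le_mono)
  qed (use Suc.prems pow in auto)
  also have "\<dots> = (\<Sum>i=m..<m + Suc d. scale_weight h i)"
    by (subst (2) sum.atLeast_Suc_lessThan) (auto simp: scale_weight_def algebra_simps)
  finally show ?case .
qed

lemma path_cost_le_total_weight:
  assumes "sorted ks"
  shows "path_cost \<kappa> ks \<le> (\<Sum>m. scale_weight h m)"
proof -
  obtain N where N: "\<And>k. k \<in> set ks \<Longrightarrow> k \<le> N"
    using finite_nat_set_iff_bounded_le[of "set ks"] by auto
  have "N \<le> 2 ^ N - 1" using less_exp[of N] by linarith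
  then have "path_cost \<kappa> ks \<le> (\<Sum>m=0..<0 + N. scale_weight h m)"
    using assms N by (intro path_cost_le_scale_weight) (fastforce intro: order_trans)+
  also have "\<dots> \<le> (\<Sum>m. scale_weight h m)"
    by (intro sum_le_suminf) auto
  finally show ?thesis .
qed

end

section \<open>Integrating the weights\<close>

definition energy :: "(nat \<Rightarrow> ennreal) \<Rightarrow> nat set \<Rightarrow> ennreal" where
  "energy f P = (\<integral>\<^sup>+k. f k * indicator P k \<partial>count_space UNIV)"

lemma energy_Un: "P \<inter> Q = {} \<Longrightarrow> energy f (P \<union> Q) = energy f P + energy f Q"
  unfolding energy_def by (subst nn_integral_add[symmetric])
    (auto intro!: nn_integral_cong simp: indicator_def)

text \<open>
  An index in the block of \<open>2 ^ a\<close> belongs to \<open>a + 1\<close> generations of dyadic intervals and to the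
  tails beginning at \<open>2 ^ 0, \<dots>, 2 ^ a\<close>. This count is where the logarithm comes from.
\<close>

lemma scales_of_index:
  "(\<Sum>m. of_nat (m + 1) * indicator {2 ^ m - 1<..2 ^ Suc m - 1} k + indicator {2 ^ m - 1<..} k)
     \<le> ennreal (4 * log 2 (real k + 1))" (is "suminf ?g \<le> _")
proof (cases "k = 0")
  case False
  obtain a where a: "2 ^ a \<le> k" "k < 2 ^ Suc a"
    using ex_power_ivl1[of 2 k] False by auto
  have iff1: "2 ^ m - 1 < k \<longleftrightarrow> m \<le> a" for m
  proof -
    have "2 ^ m - 1 < k \<longleftrightarrow> (2::nat) ^ m \<le> k"
      using False by (cases "(2::nat) ^ m") auto
    also have "\<dots> \<longleftrightarrow> m \<le> a"
    proof
      assume "2 ^ m \<le> k"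
      then have "(2::nat) ^ m < 2 ^ Suc a" using a by linarith
      then show "m \<le> a" by (simp only: power_strict_increasing_iff) 
    next
      assume "m \<le> a"
      then show "2 ^ m \<le> k" using a by (meson le_trans one_le_numeral power_increasing)
    qed
    finally show ?thesis .
  qed
  then have iff2: "k \<le> 2 ^ Suc m - 1 \<longleftrightarrow> a \<le> m" for m
    using iff1[of "Suc m"] by linarith
  have "suminf ?g = (\<Sum>m\<le>a. ?g m)"
    by (intro suminf_finite) (use iff1 in \<open>auto simp: indicator_def\<close>)
  also have "\<dots> = (\<Sum>m\<le>a. (if m = a then of_nat (a + 1) else 0) + 1)"
    by (intro sum.cong) (use iff1 iff2 in \<open>auto simp: indicator_def simp del: power_Suc\<close>)
  also have "\<dots> = of_nat (2 * (a + 1))"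
    by (simp add: sum.distrib mult_2 add_ac)
  also have "\<dots> = ennreal (real (2 * (a + 1)))"
    by (rule ennreal_of_nat_eq_real_of_nat)
  also have "\<dots> \<le> ennreal (4 * log 2 (real k + 1))"
  proof (rule ennreal_leI)
    have real_le: "2 ^ a \<le> real k + 1"
      using a(1) by (metis add_increasing2 numeral_power_le_of_nat_cancel_iff zero_le_one)
    have "real a = log 2 (2 ^ a)" by simp
    also have "\<dots> \<le> log 2 (real k + 1)"
      using real_le by (intro log_mono) auto
    finally have "real a \<le> log 2 (real k + 1)" .
    moreover have "1 \<le> log 2 (real k + 1)"
      using False by (subst le_log_iff) auto
    moreover have "real (2 * (a + 1)) = 2 * real a + 2" by simp
    ultimately show "real (2 * (a + 1)) \<le> 4 * log 2 (real k + 1)" by linarith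
  qed
  finally show ?thesis .
qed simp

locale energy_bounded_family =
  fixes M :: "'o measure" and H :: "nat set \<Rightarrow> 'o \<Rightarrow> ennreal"
    and f :: "nat \<Rightarrow> ennreal" and K :: ennreal
  assumes measurable_H [measurable]: "\<And>P. H P \<in> borel_measurable M"
    and integral_H: "\<And>P. (\<integral>\<^sup>+\<omega>. H P \<omega> \<partial>M) \<le> K * energy f P"
begin

lemma measurable_dyadic_weight [measurable]:
  "(\<lambda>\<omega>. dyadic_weight (\<lambda>P. H P \<omega>) s p) \<in> borel_measurable M"
  by (induction s arbitrary: p) auto

lemma measurable_scale_weight [measurable]:
  "(\<lambda>\<omega>. scale_weight (\<lambda>P. H P \<omega>) m) \<in> borel_measurable M"
  unfolding scale_weight_def by measurable

text \<open>
  The \<open>s + 1\<close> generations of dyadic subintervals each partition the whole interval, so each of them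
  contributes at most \<open>K\<close> times its energy.
\<close>

lemma integral_dyadic_weight:
  "(\<integral>\<^sup>+\<omega>. dyadic_weight (\<lambda>P. H P \<omega>) s p \<partial>M) \<le> K * (of_nat (s + 1) * energy f {p<..p + 2 ^ s})"
proof (induction s arbitrary: p)
  case 0
  then show ?case using integral_H[of "{p<..Suc p}"] by simp
next
  case (Suc s)
  have "{p<..p + 2 ^ Suc s} = {p<..p + 2 ^ s} \<union> {p + 2 ^ s<..p + 2 ^ s + 2 ^ s}"
    by auto
  then have E: "energy f {p<..p + 2 ^ Suc s}
      = energy f {p<..p + 2 ^ s} + energy f {p + 2 ^ s<..p + 2 ^ s + 2 ^ s}"
    by (simp only:) (intro energy_Un; auto)
  have "(\<integral>\<^sup>+\<omega>. dyadic_weight (\<lambda>P. H P \<omega>) (Suc s) p \<partial>M)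
      = (\<integral>\<^sup>+\<omega>. dyadic_weight (\<lambda>P. H P \<omega>) s p \<partial>M)
        + (\<integral>\<^sup>+\<omega>. dyadic_weight (\<lambda>P. H P \<omega>) s (p + 2 ^ s) \<partial>M)
        + (\<integral>\<^sup>+\<omega>. H {p<..p + 2 ^ Suc s} \<omega> \<partial>M)"
    by (simp add: nn_integral_add)
  also have "\<dots> \<le> K * (of_nat (s + 1) * energy f {p<..p + 2 ^ s})
      + K * (of_nat (s + 1) * energy f {p + 2 ^ s<..p + 2 ^ s + 2 ^ s})
      + K * energy f {p<..p + 2 ^ Suc s}"
    by (intro add_mono Suc.IH integral_H)
  also have "\<dots> = K * (of_nat (Suc s + 1) * energy f {p<..p + 2 ^ Suc s})"
    unfolding E by (simp add: algebra_simps)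
  finally show ?case .
qed

lemma integral_total_weight:
  "(\<integral>\<^sup>+\<omega>. (\<Sum>m. scale_weight (\<lambda>P. H P \<omega>) m) \<partial>M)
     \<le> K * (\<Sum>k. f k * ennreal (4 * log 2 (real k + 1)))"
proof -
  let ?w = "\<lambda>m k. of_nat (m + 1) * indicator {2 ^ m - 1<..2 ^ Suc m - 1} k + indicator {2 ^ m - 1<..} k :: ennreal"
  have "(\<integral>\<^sup>+\<omega>. (\<Sum>m. scale_weight (\<lambda>P. H P \<omega>) m) \<partial>M)
      = (\<Sum>m. \<integral>\<^sup>+\<omega>. scale_weight (\<lambda>P. H P \<omega>) m \<partial>M)"
    by (intro nn_integral_suminf) simp
  also have "\<dots> \<le> (\<Sum>m. K * (\<integral>\<^sup>+k. f k * ?w m k \<partial>count_space UNIV))"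
  proof (rule suminf_le)
    fix m :: nat
    have pow: "2 ^ Suc m - 1 = (2 ^ m - 1) + (2::nat) ^ m"
      by (simp add: mult_2)
    have "(\<integral>\<^sup>+\<omega>. scale_weight (\<lambda>P. H P \<omega>) m \<partial>M)
        \<le> K * (of_nat (m + 1) * energy f {2 ^ m - 1<..2 ^ Suc m - 1}) + K * energy f {2 ^ m - 1<..}"
      unfolding scale_weight_def pow
      by (subst nn_integral_add) (auto intro!: add_mono integral_H order_trans[OF integral_dyadic_weight])
    also have "\<dots> = K * (\<integral>\<^sup>+k. f k * ?w m k \<partial>count_space UNIV)"
      unfolding energy_def
      by (simp only: distrib_left[symmetric] nn_integral_cmult[symmetric] borel_measurable_count_space)
        (subst nn_integral_add[symmetric]; auto intro!: nn_integral_cong arg_cong[where f="\<lambda>x. K * x"] simp: algebra_simps)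
    finally show "(\<integral>\<^sup>+\<omega>. scale_weight (\<lambda>P. H P \<omega>) m \<partial>M) \<le> K * (\<integral>\<^sup>+k. f k * ?w m k \<partial>count_space UNIV)" .
  qed auto
  also have "\<dots> = K * (\<integral>\<^sup>+k. f k * (\<Sum>m. ?w m k) \<partial>count_space UNIV)"
    by (simp add: ennreal_suminf_cmult nn_integral_suminf[symmetric])
  also have "\<dots> \<le> K * (\<integral>\<^sup>+k. f k * ennreal (4 * log 2 (real k + 1)) \<partial>count_space UNIV)"
    by (intro mult_left_mono nn_integral_mono scales_of_index) auto
  finally show ?thesis by (simp add: nn_integral_count_space_nat)
qed

end

section \<open>The area of a path\<close>

lemma sum_pairs_nested:
  "(\<Sum>(i, j)\<in>{(i, j). k \<le> i \<and> i < j \<and> j < l}. f i j) = (\<Sum>j\<in>{k..<l}. \<Sum>i\<in>{k..<j}. f i j)"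
  for f :: "nat \<Rightarrow> nat \<Rightarrow> 'a::comm_monoid_add"
proof -
  have "(\<Sum>j\<in>{k..<l}. \<Sum>i\<in>{k..<j}. f i j) = (\<Sum>(j, i)\<in>(SIGMA j:{k..<l}. {k..<j}). f i j)"
    by (rule sum.Sigma) auto
  also have "\<dots> = (\<Sum>(i, j)\<in>{(i, j). k \<le> i \<and> i < j \<and> j < l}. f i j)"
    by (rule sum.reindex_bij_witness[where i="\<lambda>(i, j). (j, i)" and j="\<lambda>(j, i). (i, j)"]) auto
  finally show ?thesis ..
qed

text \<open>
  Completeness of the first factor is asked for here because the area is only defined for paths in
  a Banach space.
\<close>

locale banach_tensor_square = completed_tensor_square scaleV scaleW tensor
  for scaleV :: "'k::{real_normed_field, euclidean_space} \<Rightarrow> 'v::banach \<Rightarrow> 'v"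
    and scaleW :: "'k \<Rightarrow> 'w::banach \<Rightarrow> 'w"
    and tensor :: "'v \<Rightarrow> 'v \<Rightarrow> 'w"
begin

lemma additive_bracket_left: "Modules.additive (\<lambda>x. bracket tensor x y)"
  using linear_left[THEN Vector_Spaces.linear.axioms(3), THEN module_hom.add]
    linear_right[THEN Vector_Spaces.linear.axioms(3), THEN module_hom.add]
  by unfold_locales (simp add: bracket_def)

lemma additive_bracket_right: "Modules.additive (bracket tensor x)"
  using linear_left[THEN Vector_Spaces.linear.axioms(3), THEN module_hom.add]
    linear_right[THEN Vector_Spaces.linear.axioms(3), THEN module_hom.add]
  by unfold_locales (simp add: bracket_def)

lemma norm_bracket_le: "norm (bracket tensor x y) \<le> 2 * (norm x * norm y)"
  using norm_triangle_ineq4[of "tensor x y" "tensor y x"] norm_tensor_le[of x y] norm_tensor_le[of y x]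
  by (simp add: bracket_def mult.commute)

text \<open>
  Summing over the first index telescopes, by bilinearity of the bracket. In this form, a discrete
  version of the iterated integral, Chen's identity is a matter of splitting a sum. Both sides
  vanish on steps of length at most one, as the case distinction in the definition of the area
  demands.
\<close>

lemma area_eq_telescoped:
  "area tensor \<gamma> k l =
     (1 / 2) *\<^sub>R (\<Sum>j\<in>{k..<l}. bracket tensor (\<gamma> j - \<gamma> k) (\<gamma> (Suc j) - \<gamma> j))"
proof -
  let ?b = "\<lambda>i j. bracket tensor (\<gamma> (i + 1) - \<gamma> i) (\<gamma> (j + 1) - \<gamma> j)"
  have inner: "(\<Sum>i\<in>{k..<j}. ?b i j) = bracket tensor (\<gamma> j - \<gamma> k) (\<gamma> (Suc j) - \<gamma> j)"
    if "k \<le> j" for j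
    using that by (simp add: Modules.additive.sum[OF additive_bracket_left, symmetric] sum_Suc_diff' del: sum.atLeastLessThan_Suc)
  have "area tensor \<gamma> k l = (1 / 2) *\<^sub>R (\<Sum>(i, j)\<in>{(i, j). k \<le> i \<and> i < j \<and> j < l}. ?b i j)"
  proof (cases "k + 2 \<le> l")
    case False
    then have empty: "{(i, j). k \<le> i \<and> i < j \<and> j < l} = {}" by auto
    show ?thesis unfolding empty using False by (simp add: area_def)
  next
    case True
    then have "{(i, j). k \<le> i \<and> i < j \<and> j \<le> l - 1} = {(i, j). k \<le> i \<and> i < j \<and> j < l}"
      by auto
    then show ?thesis using True by (simp add: area_def)
  qed
  then show ?thesis
    by (simp only: sum_pairs_nested) (simp add: inner del: One_nat_def add_Suc_right add_0_right)
qed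

text \<open>
  Chen's identity: pairs of indices on different sides of \<open>q\<close> contribute the bracket of the two
  increments.
\<close>

lemma area_chen:
  assumes "k \<le> q" "q \<le> l"
  shows "area tensor \<gamma> k l = area tensor \<gamma> k q + area tensor \<gamma> q l
    + (1 / 2) *\<^sub>R bracket tensor (\<gamma> q - \<gamma> k) (\<gamma> l - \<gamma> q)"
proof -
  let ?d = "\<lambda>j. \<gamma> (Suc j) - \<gamma> j"
  have shift: "bracket tensor (\<gamma> j - \<gamma> k) y = bracket tensor (\<gamma> j - \<gamma> q) y + bracket tensor (\<gamma> q - \<gamma> k) y" for j y
    using Modules.additive.add[OF additive_bracket_left, of "\<gamma> j - \<gamma> q" "\<gamma> q - \<gamma> k" y] by simp
  have "(\<Sum>j\<in>{q..<l}. bracket tensor (\<gamma> j - \<gamma> k) (?d j))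
      = (\<Sum>j\<in>{q..<l}. bracket tensor (\<gamma> j - \<gamma> q) (?d j) + bracket tensor (\<gamma> q - \<gamma> k) (?d j))"
    by (intro sum.cong refl shift)
  also have "\<dots> = (\<Sum>j\<in>{q..<l}. bracket tensor (\<gamma> j - \<gamma> q) (?d j)) + bracket tensor (\<gamma> q - \<gamma> k) (\<gamma> l - \<gamma> q)"
    using assms by (simp add: sum.distrib Modules.additive.sum[OF additive_bracket_right, symmetric] sum_Suc_diff')
  finally have "(\<Sum>j\<in>{q..<l}. bracket tensor (\<gamma> j - \<gamma> k) (?d j))
      = (\<Sum>j\<in>{q..<l}. bracket tensor (\<gamma> j - \<gamma> q) (?d j)) + bracket tensor (\<gamma> q - \<gamma> k) (\<gamma> l - \<gamma> q)" .
  moreover have "(\<Sum>j\<in>{k..<l}. bracket tensor (\<gamma> j - \<gamma> k) (?d j))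
      = (\<Sum>j\<in>{k..<q}. bracket tensor (\<gamma> j - \<gamma> k) (?d j)) + (\<Sum>j\<in>{q..<l}. bracket tensor (\<gamma> j - \<gamma> k) (?d j))"
    using assms by (simp add: sum.atLeastLessThan_concat)
  ultimately show ?thesis
    unfolding area_eq_telescoped by (simp add: scaleR_add_right)
qed

lemma norm_area_split:
  assumes "k \<le> q" "q \<le> l"
  shows "norm (area tensor \<gamma> k l) \<le> norm (area tensor \<gamma> k q) + norm (area tensor \<gamma> q l)
    + norm (\<gamma> q - \<gamma> k) * norm (\<gamma> l - \<gamma> q)"
  unfolding area_chen[OF assms]
  by (intro norm_triangle_mono order_refl) (use norm_bracket_le[of "\<gamma> q - \<gamma> k" "\<gamma> l - \<gamma> q"] in simp)

end

section \<open>The rough norm\<close>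

lemma ennreal_powr_mono: "0 < a \<Longrightarrow> x \<le> y \<Longrightarrow> ennreal_powr x a \<le> ennreal_powr y a"
  by (auto simp: ennreal_powr_def top_unique less_top intro!: ennreal_leI powr_mono2 enn2real_mono)

lemma ennreal_powr_half_square: "(ennreal_powr x (1 / 2))\<^sup>2 = x"
proof (cases x)
  case (real r)
  then show ?thesis
    by (simp add: ennreal_powr_def powr_half_sqrt ennreal_power)
next
  case top
  then show ?thesis by (simp add: ennreal_powr_def power2_eq_square)
qed

lemma ennreal_powr_one: "ennreal_powr x 1 = x"
  by (cases x) (auto simp: ennreal_powr_def)

lemma p_variation_le:
  assumes "0 < p"
    and "\<And>ks. sorted ks \<Longrightarrow> path_cost (\<lambda>k l. ennreal (norm (\<alpha> k l) powr p)) ks \<le> g"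
  shows "p_variation p \<alpha> \<le> ennreal_powr g (1 / p)"
  unfolding p_variation_def
proof (intro SUP_least ennreal_powr_mono)
  fix N ks assume "ks \<in> partitions_upto N"
  then have "sorted ks" by (auto simp: partitions_upto_def strict_sorted_imp_sorted)
  then show "ennreal (\<Sum>j<length ks - 1. norm (\<alpha> (ks ! j) (ks ! (j + 1))) powr p) \<le> g"
    using assms(2)[of ks] by (simp add: path_cost_conv_sum)
qed (use assms in auto)

text \<open>
  The square cancels the root in the rough norm and the root in the \<open>2\<close>-variation, so that both
  summands are suprema of path costs.
\<close>

lemma rough_norm_square_le:
  assumes "\<And>ks. sorted ks \<Longrightarrow> path_cost (\<lambda>k l. ennreal ((norm (\<gamma> l - \<gamma> k))\<^sup>2)) ks \<le> g"
    and "\<And>ks. sorted ks \<Longrightarrow> path_cost (\<lambda>k l. ennreal (norm (\<alpha> k l))) ks \<le> g"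
  shows "(rough_norm \<gamma> \<alpha>)\<^sup>2 \<le> 2 * g"
proof -
  have "p_variation 2 (increments \<gamma>) \<le> ennreal_powr g (1 / 2)"
    using assms(1) by (intro p_variation_le) (simp_all add: increments_def norm_minus_commute)
  then have "(p_variation 2 (increments \<gamma>))\<^sup>2 \<le> (ennreal_powr g (1 / 2))\<^sup>2"
    by (rule power_mono) simp
  moreover have "p_variation 1 \<alpha> \<le> ennreal_powr g (1 / 1)"
    using assms(2) by (intro p_variation_le) simp_all
  ultimately show ?thesis
    unfolding rough_norm_def
    by (simp only: ennreal_powr_half_square div_by_1 ennreal_powr_one mult_2) (rule add_mono)
qed

section \<open>The Hardy maximal function\<close>

text \<open>
  The supremum of the Hardy property for the coefficients \<open>c\<close> restricted to \<open>P\<close>. Cutting off by a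
  zero coefficient, and not by a smaller range of summation, lets that property apply verbatim.
\<close>

definition hardy_maximal ::
    "('k::zero \<Rightarrow> 'v::real_normed_vector \<Rightarrow> 'v) \<Rightarrow> (nat \<Rightarrow> 'k) \<Rightarrow> (nat \<Rightarrow> 'o \<Rightarrow> 'v)
      \<Rightarrow> nat set \<Rightarrow> 'o \<Rightarrow> ennreal" where
  "hardy_maximal scaleV c u P \<omega> = (SUP (i, j)\<in>{(i, j). i \<le> j}.
     ennreal ((norm (\<Sum>k=i..j. scaleV (if k \<in> P then c k else 0) (u k \<omega>)))\<^sup>2))"

lemma borel_measurable_scalar_conj [measurable]:
  "(scalar_conj :: 'k::{real_normed_field, euclidean_space} \<Rightarrow> 'k) \<in> borel_measurable borel"
  unfolding scalar_conj_def[abs_def] by measurable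

lemma (in hilbert_space) ip_sum_left:
  "ip (\<Sum>k\<in>A. scale (a k) (v k)) y = (\<Sum>k\<in>A. a k * ip (v k) y)"
proof -
  have "Modules.additive (\<lambda>x. ip x y)" by unfold_locales (rule ip_add_left)
  then show ?thesis by (simp add: Modules.additive.sum[of "\<lambda>x. ip x y"] ip_scale_left)
qed

text \<open>
  The squared norm is expanded through \<open>ip\<close>, which takes values in a finite-dimensional space. Its
  axioms give linearity on the left; conjugate symmetry moves the sum in the right argument to the
  left, at the price of a conjugation, which is measurable.
\<close>

lemma (in hilbert_space) measurable_norm_sum:
  fixes u :: "nat \<Rightarrow> 'o \<Rightarrow> 'v"
  assumes gram [measurable]: "\<And>k l. (\<lambda>\<omega>. ip (u k \<omega>) (u l \<omega>)) \<in> borel_measurable M"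
  shows "(\<lambda>\<omega>. (norm (\<Sum>k\<in>A. scale (a k) (u k \<omega>)))\<^sup>2) \<in> borel_measurable M"
proof -
  let ?s = "\<lambda>\<omega>. \<Sum>k\<in>A. scale (a k) (u k \<omega>)"
  have "(norm (?s \<omega>))\<^sup>2 = norm (\<Sum>k\<in>A. a k * scalar_conj (\<Sum>l\<in>A. a l * ip (u l \<omega>) (u k \<omega>)))" for \<omega>
  proof -
    have "(norm (?s \<omega>))\<^sup>2 = norm (ip (?s \<omega>) (?s \<omega>))" by (simp only: ip_norm norm_of_real abs_power2)
    also have "ip (?s \<omega>) (?s \<omega>) = (\<Sum>k\<in>A. a k * scalar_conj (ip (?s \<omega>) (u k \<omega>)))"
      by (subst ip_sum_left) (simp only: ip_commute[of "u _ \<omega>" "?s \<omega>"])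
    finally show ?thesis by (simp only: ip_sum_left)
  qed
  then show ?thesis by simp
qed

lemma partial_sum_process_increment:
  assumes "k \<le> l"
  shows "partial_sum_process scaleV c u l \<omega> - partial_sum_process scaleV c u k \<omega>
    = (\<Sum>n=Suc k..l. scaleV (c n) (u n \<omega>))"
proof -
  have "{..l} = {..k} \<union> {Suc k..l}" "{..k} \<inter> {Suc k..l} = {}" using assms by auto
  then show ?thesis by (simp add: partial_sum_process_def sum.union_disjoint)
qed

lemma increment_le_hardy_maximal:
  assumes "k \<le> l" "{k<..l} \<subseteq> P"
  shows "ennreal ((norm (partial_sum_process scaleV c u l \<omega> - partial_sum_process scaleV c u k \<omega>))\<^sup>2)
    \<le> hardy_maximal scaleV c u P \<omega>"
proof (cases "k = l")
  case False
  have "(\<Sum>n=Suc k..l. scaleV (c n) (u n \<omega>)) = (\<Sum>n=Suc k..l. scaleV (if n \<in> P then c n else 0) (u n \<omega>))"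
    using assms by (intro sum.cong) (auto simp: atLeastSucAtMost_greaterThanAtMost)
  then show ?thesis
    unfolding hardy_maximal_def partial_sum_process_increment[OF assms(1)]
    using assms False by (intro SUP_upper2[of "(Suc k, l)"]) auto
qed simp

lemma splittable_cost_square_increment:
  "splittable_cost
    (\<lambda>k l. ennreal ((norm (partial_sum_process scaleV c u l \<omega> - partial_sum_process scaleV c u k \<omega>))\<^sup>2))
    (\<lambda>P. hardy_maximal scaleV c u P \<omega>)"
  by unfold_locales (auto intro!: increment_le_hardy_maximal add_increasing)

text \<open>
  The cross term of Chen's identity is a product of two increments within \<open>P\<close>, hence at most the
  larger of their squares.
\<close>

lemma (in banach_tensor_square) splittable_cost_area:
  "splittable_cost
    (\<lambda>k l. ennreal (norm (area tensor (\<lambda>n. partial_sum_process scaleV c u n \<omega>) k l)))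
    (\<lambda>P. hardy_maximal scaleV c u P \<omega>)"
proof
  let ?X = "\<lambda>n. partial_sum_process scaleV c u n \<omega>" and ?H = "\<lambda>P. hardy_maximal scaleV c u P \<omega>"
  fix k q l :: nat and P assume kql: "k \<le> q" "q \<le> l" "{k<..l} \<subseteq> P"
  let ?x = "norm (?X q - ?X k)" and ?y = "norm (?X l - ?X q)"
  have "ennreal (?x * ?y) \<le> ennreal (max (?x\<^sup>2) (?y\<^sup>2))"
  proof (rule ennreal_leI)
    show "?x * ?y \<le> max (?x\<^sup>2) (?y\<^sup>2)"
      using mult_right_mono[of ?x ?y ?y] mult_left_mono[of ?y ?x ?x]
      by (cases "?x \<le> ?y") (auto simp: power2_eq_square)
  qed
  also have "\<dots> \<le> ?H P"
  proof -
    have "ennreal (?x\<^sup>2) \<le> ?H P" "ennreal (?y\<^sup>2) \<le> ?H P"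
      using kql by (auto intro!: increment_le_hardy_maximal)
    then show ?thesis by (simp add: max_def)
  qed
  finally have xy: "ennreal (?x * ?y) \<le> ?H P" .
  have "ennreal (norm (area tensor ?X k l))
      \<le> ennreal (norm (area tensor ?X k q) + norm (area tensor ?X q l) + ?x * ?y)"
    using kql by (intro ennreal_leI norm_area_split)
  also have "\<dots> = ennreal (norm (area tensor ?X k q)) + ennreal (norm (area tensor ?X q l)) + ennreal (?x * ?y)"
    by simp
  also have "\<dots> \<le> ennreal (norm (area tensor ?X k q)) + ennreal (norm (area tensor ?X q l)) + ?H P"
    using xy by (rule add_left_mono)
  finally show "ennreal (norm (area tensor ?X k l))
      \<le> ennreal (norm (area tensor ?X k q)) + ennreal (norm (area tensor ?X q l)) + ?H P" .
qed (simp_all add: area_def)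

text \<open>
  This is the Hardy property for the truncated coefficients. A negative constant is harmless, as
  both \<open>ennreal C\<close> and the bound in the Hardy property are then \<open>0\<close>.
\<close>

lemma energy_bounded_hardy_maximal:
  assumes "hilbert_space scaleV ip" "orthonormal_system M ip u" "hardy_property M scaleV u C"
    and summable: "summable (\<lambda>n. (norm (c n))\<^sup>2)"
  shows "energy_bounded_family M (hardy_maximal scaleV c u) (\<lambda>n. ennreal ((norm (c n))\<^sup>2)) (ennreal C)"
proof
  interpret hilbert_space scaleV ip by fact
  fix P :: "nat set"
  have "(\<lambda>\<omega>. ip (u k \<omega>) (u l \<omega>)) \<in> borel_measurable M" for k l
    using assms(2) by (auto simp: orthonormal_system_def dest: borel_measurable_has_bochner_integral)
  note partial_sums = measurable_norm_sum[OF this]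
  have "countable {(i::nat, j). i \<le> j}" by (rule countableI_type)
  then show "hardy_maximal scaleV c u P \<in> borel_measurable M"
    unfolding hardy_maximal_def[abs_def]
    by (intro borel_measurable_SUP) (auto intro: measurable_compose[OF partial_sums measurable_ennreal])
  let ?a = "\<lambda>n. if n \<in> P then c n else 0"
  have summable_a: "summable (\<lambda>n. (norm (?a n))\<^sup>2)"
    by (rule summable_comparison_test[OF _ summable]) auto
  then have "(\<integral>\<^sup>+\<omega>. hardy_maximal scaleV c u P \<omega> \<partial>M) \<le> ennreal (C * (\<Sum>n. (norm (?a n))\<^sup>2))"
    unfolding hardy_maximal_def by (rule assms(3)[unfolded hardy_property_def, rule_format])
  also have "\<dots> = ennreal C * (\<Sum>n. ennreal ((norm (?a n))\<^sup>2))"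
    using summable_a by (simp add: ennreal_mult'' suminf_nonneg suminf_ennreal2)
  also have "(\<Sum>n. ennreal ((norm (?a n))\<^sup>2)) = energy (\<lambda>n. ennreal ((norm (c n))\<^sup>2)) P"
    unfolding energy_def nn_integral_count_space_nat by (intro suminf_cong) auto
  finally show "(\<integral>\<^sup>+\<omega>. hardy_maximal scaleV c u P \<omega> \<partial>M)
      \<le> ennreal C * energy (\<lambda>n. ennreal ((norm (c n))\<^sup>2)) P" .
qed

theorem theorem16:
  fixes M :: "'o measure"
    and scaleV :: "'k::{real_normed_field, euclidean_space} \<Rightarrow> 'v::banach \<Rightarrow> 'v"
    and ip :: "'v \<Rightarrow> 'v \<Rightarrow> 'k"
    and scaleW :: "'k \<Rightarrow> 'w::banach \<Rightarrow> 'w"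
    and tensor :: "'v \<Rightarrow> 'v \<Rightarrow> 'w"
    and u :: "nat \<Rightarrow> 'o \<Rightarrow> 'v"
    and c :: "nat \<Rightarrow> 'k"
    and C :: real
    and X :: "nat \<Rightarrow> 'o \<Rightarrow> 'v"
  assumes "hilbert_space scaleV ip"
    and "completed_tensor_square scaleV scaleW tensor"
    and "orthonormal_system M ip u"
    and "hardy_property M scaleV u C"
    and "summable (\<lambda>n. log 2 (real n + 1) * (norm (c n))\<^sup>2)"
    and "X = partial_sum_process scaleV c u"
  shows "geometric_2_rough_process M tensor X \<and>
    (\<integral>\<^sup>+\<omega>. (rough_norm (\<lambda>n. X n \<omega>) (area tensor (\<lambda>n. X n \<omega>)))\<^sup>2 \<partial>M)
      \<le> ennreal ((604 + 26 * C) * (\<Sum>n. log 2 (real n + 1) * (norm (c n))\<^sup>2))"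
proof -
  interpret banach_tensor_square scaleV scaleW tensor
    using assms(2) by (rule banach_tensor_square.intro)
  let ?G = "\<lambda>\<omega>. \<Sum>m. scale_weight (\<lambda>P. hardy_maximal scaleV c u P \<omega>) m"
  let ?S = "\<Sum>n. log 2 (real n + 1) * (norm (c n))\<^sup>2"
  have nonneg: "0 \<le> log 2 (real n + 1) * (norm (c n))\<^sup>2" for n by simp
  (* The weight log 2 (n + 1) is at least 1 for every n except 0. *)
  have "summable (\<lambda>n. (norm (c n))\<^sup>2)"
  proof (rule summable_comparison_test_ev[OF _ assms(5)])
    have "norm ((norm (c n))\<^sup>2) \<le> log 2 (real n + 1) * (norm (c n))\<^sup>2" if "1 \<le> n" for n
    proof -
      have "1 \<le> log 2 (real n + 1)" using that by (subst le_log_iff) auto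
      from mult_right_mono[OF this, of "(norm (c n))\<^sup>2"] show ?thesis by simp
    qed
    then show "\<forall>\<^sub>F n in sequentially. norm ((norm (c n))\<^sup>2) \<le> log 2 (real n + 1) * (norm (c n))\<^sup>2"
      by (auto simp: eventually_sequentially)
  qed
  then interpret energy_bounded_family M "hardy_maximal scaleV c u" "\<lambda>n. ennreal ((norm (c n))\<^sup>2)" "ennreal C"
    using assms by (intro energy_bounded_hardy_maximal)
  have measurable_G [measurable]: "?G \<in> borel_measurable M" by measurable
  have "(\<integral>\<^sup>+\<omega>. ?G \<omega> \<partial>M) \<le> ennreal C * (\<Sum>n. ennreal ((norm (c n))\<^sup>2) * ennreal (4 * log 2 (real n + 1)))"
    by (rule integral_total_weight)
  also have "(\<Sum>n. ennreal ((norm (c n))\<^sup>2) * ennreal (4 * log 2 (real n + 1)))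
      = (\<Sum>n. 4 * ennreal (log 2 (real n + 1) * (norm (c n))\<^sup>2))"
    by (intro suminf_cong) (simp add: ennreal_mult mult_ac)
  also have "\<dots> = 4 * ennreal ?S"
    using assms(5) nonneg by (simp add: ennreal_suminf_cmult suminf_ennreal2)
  finally have integral_G: "(\<integral>\<^sup>+\<omega>. ?G \<omega> \<partial>M) \<le> ennreal C * (4 * ennreal ?S)" .
  then have "(\<integral>\<^sup>+\<omega>. ?G \<omega> \<partial>M) < top"
    by (rule order_le_less_trans) (simp add: ennreal_mult_less_top)
  then have "AE \<omega> in M. ?G \<omega> \<noteq> \<infinity>"
    by (intro nn_integral_PInf_AE) auto
  moreover have rough: "(rough_norm (\<lambda>n. X n \<omega>) (area tensor (\<lambda>n. X n \<omega>)))\<^sup>2 \<le> 2 * ?G \<omega>" for \<omega>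
    unfolding assms(6)
    by (intro rough_norm_square_le splittable_cost.path_cost_le_total_weight
        splittable_cost_square_increment splittable_cost_area)
  have "rough_norm (\<lambda>n. X n \<omega>) (area tensor (\<lambda>n. X n \<omega>)) < top" if "?G \<omega> \<noteq> \<infinity>" for \<omega>
  proof -
    have "(rough_norm (\<lambda>n. X n \<omega>) (area tensor (\<lambda>n. X n \<omega>)))\<^sup>2 < top"
      using that by (intro order_le_less_trans[OF rough]) (simp add: ennreal_mult_less_top less_top)
    then show ?thesis by (simp add: power_less_top_ennreal)
  qed
  ultimately have "geometric_2_rough_process M tensor X"
    unfolding geometric_2_rough_process_def geometric_2_rough_path_def by auto
  moreover have "(\<integral>\<^sup>+\<omega>. (rough_norm (\<lambda>n. X n \<omega>) (area tensor (\<lambda>n. X n \<omega>)))\<^sup>2 \<partial>M)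
      \<le> ennreal ((604 + 26 * C) * ?S)"
  proof -
    have "(\<integral>\<^sup>+\<omega>. (rough_norm (\<lambda>n. X n \<omega>) (area tensor (\<lambda>n. X n \<omega>)))\<^sup>2 \<partial>M) \<le> (\<integral>\<^sup>+\<omega>. 2 * ?G \<omega> \<partial>M)"
      by (intro nn_integral_mono rough)
    also have "\<dots> = 2 * (\<integral>\<^sup>+\<omega>. ?G \<omega> \<partial>M)"
      by (intro nn_integral_cmult) simp
    also have "\<dots> \<le> 2 * (ennreal C * (4 * ennreal ?S))"
      by (intro mult_left_mono integral_G) simp
    (* ennreal truncates negative numbers to 0, hence the maximum. *)
    also have "\<dots> = ennreal (8 * max C 0) * ennreal ?S"
      by (simp add: ennreal_mult' max_def ennreal_neg mult_ac)
    also have "\<dots> \<le> ennreal ((604 + 26 * C) * ?S)"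
    proof (cases "0 \<le> C")
      case True
      have "0 \<le> ?S" using assms(5) nonneg by (intro suminf_nonneg)
      then show ?thesis using True
        by (simp flip: ennreal_mult) (intro ennreal_leI mult_right_mono; simp)
    qed simp
    finally show ?thesis .
  qed
  ultimately show ?thesis by blast
qed

end
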